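(* Let $S(\mathbf{G},\mathbf{\Sigma})$ be a constrained switching system with $\mathbf{\Sigma}\subset\mathbb{R}^{n\times n}$ and let $M\ge1$ be an integer. Then the value $\gamma_*=\gamma_*(S_M)$ of the $M$-path-dependent lift $S_M$ of $S$ satisfies $$\hat\rho(S)\le\gamma_*\le n^{1/(2(M+1))}\,\hat\rho(S).$$
   Context: An automaton $\mathbf{G}(V,E)$ is a strongly connected directed graph with finite node set $V$ and finite edge set $E$ of labelled edges $(v,w,\sigma)$, $\sigma$ indexing a matrix $A_\sigma\in\mathbf{\Sigma}$. A path of length $T$ is a sequence of $T$ consecutive edges; a label sequence is accepted if it is the label sequence of some path (no prescribed initial/final node). The constrained switching system $S(\mathbf{G},\mathbf{\Sigma})$ is $x_{t+1}=A_{\sigma(t)}x_t$ with accepted switching sequences; its CJSR is $\hat\rho(S)=\lim_{t\to\infty}\max\{\|A_{\sigma(t-1)}\cdots A_{\sigma(0)}\|^{1/t} : \sigma(0),\dots,\sigma(t-1)\text{ accepted}\}$. $M$-path-dependent lift $S_M$ ($M\ge1$): same matrix set $\mathbf{\Sigma}$; automaton with one node $v_p$ per path $p$ of length $M$ in $\mathbf{G}$, and for each path $p=(e_1,\dots,e_{M+1})$ of length $M+1$ in $\mathbf{G}$ an edge $(v_{p^-},v_{p^+},\sigma_p)$ with $p^-=(e_1,\dots,e_M)$, $p^+=(e_2,\dots,e_{M+1})$ and $\sigma_p$ the label of $e_{M+1}$. For a constrained switching system $S'$ on automaton $(V',E')$, $\gamma_*(S')$ is the infimum of $\gamma$ such that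 there exist symmetric $Q_v\succ0$ ($v\in V'$) with $\gamma^2Q_v-A_\sigma^\top Q_wA_\sigma\succeq0$ for all $(v,w,\sigma)\in E'$. *)

theory Defs
  imports "HOL-Analysis.Analysis"
begin

text \<open>Labelled edges (v, w, sigma) of an automaton.\<close>

definition edge_src :: "'v \<times> 'v \<times> 's \<Rightarrow> 'v" where
  "edge_src e = fst e"

definition edge_tgt :: "'v \<times> 'v \<times> 's \<Rightarrow> 'v" where
  "edge_tgt e = fst (snd e)"

definition edge_lbl :: "'v \<times> 'v \<times> 's \<Rightarrow> 's" where
  "edge_lbl e = snd (snd e)"

text \<open>An automaton: finite node set, finite edge set between nodes, strongly connected.\<close>

definition automaton :: "'v set \<Rightarrow> ('v \<times> 'v \<times> 's) set \<Rightarrow> bool" where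
  "automaton V E \<longleftrightarrow> finite V \<and> finite E \<and>
     (\<forall>e\<in>E. edge_src e \<in> V \<and> edge_tgt e \<in> V) \<and>
     (\<forall>v\<in>V. \<forall>w\<in>V. (v, w) \<in> {(a, b). \<exists>s. (a, b, s) \<in> E}\<^sup>*)"

text \<open>A path is a list of consecutive edges of E; its length is the number of edges.\<close>

definition is_path :: "('v \<times> 'v \<times> 's) set \<Rightarrow> ('v \<times> 'v \<times> 's) list \<Rightarrow> bool" where
  "is_path E p \<longleftrightarrow> set p \<subseteq> E \<and>
     (\<forall>i. Suc i < length p \<longrightarrow> edge_tgt (p ! i) = edge_src (p ! Suc i))"

text \<open>Product A_{sigma(t-1)} ... A_{sigma(0)} for the label list [sigma(0), ..., sigma(t-1)].\<close>

fun mat_prod_seq :: "('s \<Rightarrow> real^'n^'n) \<Rightarrow> 's list \<Rightarrow> real^'n^'n" where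
  "mat_prod_seq A [] = mat 1"
| "mat_prod_seq A (s # ss) = mat_prod_seq A ss ** A s"

text \<open>Operator (induced Euclidean) norm of a matrix.\<close>

definition mnorm :: "real^'n^'n \<Rightarrow> real" where
  "mnorm B = onorm (\<lambda>x. B *v x)"

text \<open>Constrained joint spectral radius of S(G, Sigma): the limit of
  max over accepted label sequences of length t of the t-th root of the norm of the product.\<close>

definition cjsr :: "('v \<times> 'v \<times> 's) set \<Rightarrow> ('s \<Rightarrow> real^'n^'n) \<Rightarrow> real" where
  "cjsr E A = lim (\<lambda>t. Max {mnorm (mat_prod_seq A (map edge_lbl p)) powr (1 / real t) |
                              p. is_path E p \<and> length p = t})"

definition psd :: "real^'n^'n \<Rightarrow> bool" where
  "psd B \<longleftrightarrow> (\<forall>x. 0 \<le> x \<bullet> (B *v x))"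

definition pos_def :: "real^'n^'n \<Rightarrow> bool" where
  "pos_def B \<longleftrightarrow> (\<forall>x. x \<noteq> 0 \<longrightarrow> 0 < x \<bullet> (B *v x))"

text \<open>gamma_* of the constrained switching system on automaton (V', E') with matrices A.\<close>

definition gamma_star :: "'w set \<Rightarrow> ('w \<times> 'w \<times> 's) set \<Rightarrow> ('s \<Rightarrow> real^'n^'n) \<Rightarrow> real" where
  "gamma_star V' E' A = Inf {\<gamma>. 0 \<le> \<gamma> \<and>
     (\<exists>Q :: 'w \<Rightarrow> real^'n^'n.
        (\<forall>v\<in>V'. transpose (Q v) = Q v \<and> pos_def (Q v)) \<and>
        (\<forall>(v, w, \<sigma>)\<in>E'. psd ((\<gamma>\<^sup>2) *\<^sub>R Q v - transpose (A \<sigma>) ** Q w ** A \<sigma>)))}"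

text \<open>M-path-dependent lift: nodes are paths of length M, edges come from paths of length M+1.\<close>

definition lift_nodes :: "('v \<times> 'v \<times> 's) set \<Rightarrow> nat \<Rightarrow> ('v \<times> 'v \<times> 's) list set" where
  "lift_nodes E M = {p. is_path E p \<and> length p = M}"

definition lift_edges :: "('v \<times> 'v \<times> 's) set \<Rightarrow> nat \<Rightarrow>
    (('v \<times> 'v \<times> 's) list \<times> ('v \<times> 'v \<times> 's) list \<times> 's) set" where
  "lift_edges E M = {(take M p, drop 1 p, edge_lbl (last p)) | p. is_path E p \<and> length p = Suc M}"

end

theory Submission
  imports Defs
begin

text \<open>Lower bound: matrices Q on the lift that are feasible for \<gamma> form a path-dependent quadratic
  Lyapunov function. Prefixing any path of the automaton by a history of length M (which exists
  by strong connectivity) shows that all products of length t have norm at most K \<gamma>^t, so the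
  CJSR is at most \<gamma>.

  Upper bound: for r above the CJSR, normalised images r^-|q| A_q u of unit vectors along the
  paths q ending at a node v form a bounded set, whose support function is a dual extremal norm
  that contracts by r along every edge. A maximal-determinant (John) argument replaces it by a
  quadratic form R_v at the cost of a factor n. Summing the forms R transported along the last
  M edges of a history, with weights \<gamma>^-2k, and inverting gives matrices Q on the lift; the
  factor n is paid only once every M + 1 steps, hence \<gamma> = n^(1/(2(M+1))) r suffices.\<close>

section \<open>Quadratic forms\<close>

definition qform :: "real^'n^'n \<Rightarrow> real^'n \<Rightarrow> real" where
  "qform X x = x \<bullet> (X *v x)"

lemma inner_matrix_vector_transpose: "x \<bullet> ((A::real^'n^'n) *v y) = (transpose A *v x) \<bullet> y"
  by (simp add: dot_lmul_matrix)

lemma qform_add: "qform (X + Y) x = qform X x + qform Y x"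
  unfolding qform_def by (simp add: matrix_vector_mult_add_rdistrib inner_add_right)

lemma qform_diff: "qform (X - Y) x = qform X x - qform Y x"
  unfolding qform_def by (simp add: matrix_vector_mult_diff_rdistrib inner_diff_right)

lemma qform_scaleR: "qform (c *\<^sub>R X) x = c * qform X x"
  unfolding qform_def by (simp add: scaleR_matrix_vector_assoc[symmetric])

lemma qform_congruence: "qform (transpose B ** Q ** B) x = qform Q (B *v x)"
  for B Q :: "real^'n^'n"
proof -
  have "(transpose B ** Q ** B) *v x = transpose B *v (Q *v (B *v x))"
    by (simp only: matrix_vector_mul_assoc matrix_mul_assoc)
  then show ?thesis
    unfolding qform_def
    using inner_matrix_vector_transpose[of x "transpose B" "Q *v (B *v x)"]
    by (simp only: transpose_transpose)
qed

lemma qform_congruence_transpose: "qform (B ** Q ** transpose B) x = qform Q (transpose B *v x)"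
  for B Q :: "real^'n^'n"
  using qform_congruence[of "transpose B" Q x] by simp

lemma psd_iff_qform: "psd X \<longleftrightarrow> (\<forall>x. 0 \<le> qform X x)"
  by (simp add: psd_def qform_def)

lemma pos_def_iff_qform: "pos_def X \<longleftrightarrow> (\<forall>x. x \<noteq> 0 \<longrightarrow> 0 < qform X x)"
  by (simp add: pos_def_def qform_def)

lemma pos_def_qform_nonneg: "pos_def X \<Longrightarrow> 0 \<le> qform X x"
  unfolding pos_def_iff_qform by (cases "x = 0") (auto simp: qform_def intro: less_imp_le)

lemma pos_def_if_qform_ge_norm:
  fixes X :: "real^'n^'n"
  assumes "\<And>x. (norm x)\<^sup>2 \<le> qform X x"
  shows "pos_def X"
  unfolding pos_def_iff_qform
proof (intro allI impI)
  fix x :: "real^'n" assume "x \<noteq> 0"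
  then have "0 < (norm x)\<^sup>2" by simp
  also have "\<dots> \<le> qform X x" by (rule assms)
  finally show "0 < qform X x" .
qed

lemma psd_lmi_iff:
  fixes B Q Q' :: "real^'n^'n"
  shows "psd (g *\<^sub>R Q - transpose B ** Q' ** B) \<longleftrightarrow> (\<forall>x. qform Q' (B *v x) \<le> g * qform Q x)"
  unfolding psd_iff_qform qform_diff qform_scaleR qform_congruence by simp

lemma qform_le_mnorm: "qform X x \<le> mnorm X * (norm x)\<^sup>2"
proof -
  have "qform X x \<le> norm x * norm (X *v x)"
    unfolding qform_def by (rule norm_cauchy_schwarz)
  also have "\<dots> \<le> norm x * (mnorm X * norm x)"
    using onorm[OF matrix_vector_mul_bounded_linear[of X], of x] unfolding mnorm_def
    by (intro mult_left_mono) auto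
  finally show ?thesis by (simp add: power2_eq_square algebra_simps)
qed

lemma pos_def_coercive:
  fixes Q :: "real^'n^'n"
  assumes "pos_def Q"
  obtains c where "0 < c" "\<And>x. c * (norm x)\<^sup>2 \<le> qform Q x"
proof -
  have cont: "continuous_on (sphere 0 1) (qform Q)"
    unfolding qform_def by (intro continuous_intros)
  obtain a :: "real^'n" where "norm a = 1"
    using vector_choose_size[of 1] by auto
  then have nonempty: "sphere (0::real^'n) 1 \<noteq> {}" by auto
  obtain x0 where x0: "x0 \<in> sphere 0 1" and min: "\<And>y. y \<in> sphere 0 1 \<Longrightarrow> qform Q x0 \<le> qform Q y"
    using continuous_attains_inf[OF compact_sphere nonempty cont] by blast
  have "x0 \<noteq> 0" using x0 by auto
  then have "0 < qform Q x0"
    using assms unfolding pos_def_iff_qform by auto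
  moreover have "qform Q x0 * (norm x)\<^sup>2 \<le> qform Q x" for x
  proof (cases "x = 0")
    case False
    have "qform Q x0 \<le> qform Q ((1 / norm x) *\<^sub>R x)"
      using False by (intro min) simp
    also have "\<dots> = qform Q x / (norm x)\<^sup>2"
      by (simp add: qform_def matrix_vector_mult_scaleR power2_eq_square)
    finally show ?thesis using False by (simp add: le_divide_eq)
  qed (simp add: qform_def)
  ultimately show thesis by (rule that)
qed

lemma qform_cauchy_schwarz:
  fixes Q :: "real^'n^'n"
  assumes sym: "transpose Q = Q" and psd: "\<And>x. 0 \<le> qform Q x"
  shows "(u \<bullet> (Q *v z))\<^sup>2 \<le> qform Q u * qform Q z"
proof -
  let ?a = "qform Q u" and ?b = "u \<bullet> (Q *v z)" and ?c = "qform Q z"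
  have "z \<bullet> (Q *v u) = ?b"
    by (metis sym inner_commute inner_matrix_vector_transpose)
  then have expand: "qform Q (u + s *\<^sub>R z) = ?a + 2 * s * ?b + s\<^sup>2 * ?c" for s
    by (simp add: qform_def matrix_vector_right_distrib matrix_vector_mult_scaleR inner_add_left
        inner_add_right power2_eq_square algebra_simps)
  have nonneg: "0 \<le> ?a + 2 * s * ?b + s\<^sup>2 * ?c" for s
    using psd[of "u + s *\<^sub>R z"] expand by simp
  show ?thesis
  proof (cases "?c = 0")
    case True
    have "?b = 0"
    proof (rule ccontr)
      assume "?b \<noteq> 0"
      then have "?a + 2 * (- (?a + 1) / (2 * ?b)) * ?b = -1" by (simp add: field_simps)
      with nonneg[of "- (?a + 1) / (2 * ?b)"] True show False by simp
    qed
    then show ?thesis using True by simp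
  next
    case False
    then have c: "0 < ?c" using psd[of z] by simp
    have "0 \<le> ?a + 2 * (- ?b / ?c) * ?b + (- ?b / ?c)\<^sup>2 * ?c" by (rule nonneg)
    also have "\<dots> = ?a - ?b\<^sup>2 / ?c" using c by (simp add: field_simps power2_eq_square)
    finally show ?thesis using c by (simp add: divide_le_eq mult.commute)
  qed
qed

lemma invertible_matrix_inv:
  fixes A :: "real^'n^'n"
  assumes "invertible A"
  shows "A ** matrix_inv A = mat 1" "matrix_inv A ** A = mat 1"
proof -
  have "\<exists>A'. A ** A' = mat 1 \<and> A' ** A = mat 1"
    using assms unfolding invertible_def by blast
  then have "A ** matrix_inv A = mat 1 \<and> matrix_inv A ** A = mat 1"
    unfolding matrix_inv_def by (rule someI_ex)
  then show "A ** matrix_inv A = mat 1" "matrix_inv A ** A = mat 1" by auto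
qed

lemma pos_def_invertible:
  fixes P :: "real^'n^'n"
  assumes "pos_def P"
  shows "invertible P"
proof -
  have "inj ((*v) P)"
  proof (rule injI)
    fix x y assume "P *v x = P *v y"
    then have "qform P (x - y) = 0"
      by (simp add: qform_def matrix_vector_mult_diff_distrib)
    with assms show "x = y"
      unfolding pos_def_iff_qform by (metis less_irrefl right_minus_eq)
  qed
  then have "det P \<noteq> 0"
    using det_nz_iff_inj[of "(*v) P"] by (simp add: matrix_of_matrix_vector_mul)
  then show ?thesis by (simp add: invertible_det_nz)
qed

lemma pos_def_matrix_inv:
  fixes P :: "real^'n^'n"
  assumes sym: "transpose P = P" and pd: "pos_def P"
  shows "transpose (matrix_inv P) = matrix_inv P" "pos_def (matrix_inv P)"
proof -
  let ?Q = "matrix_inv P"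
  note inv = invertible_matrix_inv[OF pos_def_invertible[OF pd]]
  have t: "transpose ?Q ** P = mat 1"
    using arg_cong[OF inv(1), of transpose] sym by (simp add: matrix_transpose_mul)
  have "transpose ?Q = transpose ?Q ** (P ** ?Q)" using inv(1) by simp
  also have "\<dots> = (transpose ?Q ** P) ** ?Q" by (simp add: matrix_mul_assoc)
  also have "\<dots> = ?Q" using t by simp
  finally show "transpose ?Q = ?Q" .
  show "pos_def ?Q"
    unfolding pos_def_iff_qform
  proof (intro allI impI)
    fix x :: "real^'n" assume "x \<noteq> 0"
    let ?w = "?Q *v x"
    have Pw: "P *v ?w = x" using inv(1) by (simp add: matrix_vector_mul_assoc)
    then have "?w \<noteq> 0" using \<open>x \<noteq> 0\<close> by auto
    then have "0 < qform P ?w" using pd unfolding pos_def_iff_qform by auto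
    also have "qform P ?w = qform ?Q x" using Pw by (simp add: qform_def inner_commute)
    finally show "0 < qform ?Q x" .
  qed
qed

lemma qform_matrix_inv_transfer:
  fixes A P1 P2 :: "real^'n^'n"
  assumes sym1: "transpose P1 = P1" and pd1: "pos_def P1"
    and sym2: "transpose P2 = P2" and pd2: "pos_def P2"
    and c: "0 \<le> c" and le: "\<And>y. qform P1 (transpose A *v y) \<le> c * qform P2 y"
  shows "qform (matrix_inv P2) (A *v x) \<le> c * qform (matrix_inv P1) x"
proof -
  let ?Q1 = "matrix_inv P1" and ?Q2 = "matrix_inv P2"
  note inv1 = invertible_matrix_inv[OF pos_def_invertible[OF pd1]]
  note inv2 = invertible_matrix_inv[OF pos_def_invertible[OF pd2]]
  define y where "y = ?Q2 *v (A *v x)"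
  define s where "s = qform ?Q2 (A *v x)"
  have s: "0 \<le> s" "0 \<le> qform ?Q1 x"
    unfolding s_def using pos_def_qform_nonneg pos_def_matrix_inv(2) pd1 pd2 sym1 sym2 by auto
  have x: "x = P1 *v (?Q1 *v x)" using inv1(1) by (simp add: matrix_vector_mul_assoc)
  have "P2 *v y = (P2 ** ?Q2) *v (A *v x)"
    unfolding y_def by (rule matrix_vector_mul_assoc)
  then have P2y: "P2 *v y = A *v x" using inv2(1) by simp
  have "s = (transpose A *v y) \<bullet> (P1 *v (?Q1 *v x))"
    unfolding s_def qform_def y_def
    by (subst x[symmetric], subst inner_commute) (rule inner_matrix_vector_transpose)
  then have "s\<^sup>2 \<le> qform P1 (transpose A *v y) * qform P1 (?Q1 *v x)"
    using qform_cauchy_schwarz[OF sym1 pos_def_qform_nonneg[OF pd1]] by simp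
  also have "qform P1 (?Q1 *v x) = qform ?Q1 x"
    using x by (simp add: qform_def inner_commute)
  also have "qform P1 (transpose A *v y) \<le> c * qform P2 y" by (rule le)
  also have "qform P2 y = s"
    unfolding s_def qform_def P2y by (simp add: y_def inner_commute)
  finally have "s * s \<le> s * (c * qform ?Q1 x)"
    using s by (simp add: power2_eq_square mult_right_mono mult_ac)
  then have "s \<le> c * qform ?Q1 x"
    using s c by (cases "s = 0") auto
  then show ?thesis unfolding s_def .
qed

section \<open>Rank-one updates of determinants\<close>

definition outer_prod :: "real^'n \<Rightarrow> real^'n \<Rightarrow> real^'n^'n" where
  "outer_prod w u = (\<chi> i j. w$i * u$j)"

lemma outer_prod_mult: "outer_prod w u *v z = (u \<bullet> z) *\<^sub>R w"
  by (simp add: vec_eq_iff outer_prod_def matrix_vector_mult_def inner_vec_def sum_distrib_left mult_ac)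

lemma qform_outer_prod: "qform (outer_prod b b) z = (b \<bullet> z)\<^sup>2"
  by (simp add: qform_def outer_prod_mult power2_eq_square inner_commute)

lemma matrix_mul_outer_prod: "(M::real^'n^'n) ** outer_prod w u = outer_prod (M *v w) u"
  by (simp add: vec_eq_iff outer_prod_def matrix_matrix_mult_def matrix_vector_mult_def
      sum_distrib_right mult.assoc)

lemma outer_prod_scaleR: "outer_prod (s *\<^sub>R w) u = s *\<^sub>R outer_prod w u"
  by (simp add: vec_eq_iff outer_prod_def)

lemma transpose_outer_prod: "transpose (outer_prod b b) = outer_prod b b"
  by (simp add: vec_eq_iff outer_prod_def transpose_def mult.commute)

lemma det_unit_rows_replace:
  fixes u :: "real^'n" and c :: "'n \<Rightarrow> real"
  assumes "finite S" "k \<notin> S"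
  shows "det (\<chi> i. if i = k then u else if i \<in> S then row i (mat 1) + c i *s u
                  else row i (mat 1 :: real^'n^'n)) = u$k"
  using assms
proof (induction S rule: finite_induct)
  case empty
  have expand: "sum (\<lambda>i. u$i *s row i (mat 1 :: real^'n^'n)) UNIV = u"
    by (simp add: vec_eq_iff row_def mat_def sum_component if_distrib cong: if_cong)
  have "(\<chi> i. if i = k then u else if i \<in> {} then row i (mat 1) + c i *s u else row i (mat 1 :: real^'n^'n))
      = (\<chi> i. if i = k then sum (\<lambda>i. u$i *s row i (mat 1 :: real^'n^'n)) UNIV else row i (mat 1))"
    unfolding expand by (intro arg_cong[where f=vec_lambda] ext) simp
  also have "det \<dots> = u$k * det (mat 1 :: real^'n^'n)" by (rule cramer_lemma_transpose)
  finally show ?case by simp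
next
  case (insert j S)
  define Z where "Z = (\<chi> i. if i = k then u else if i \<in> S then row i (mat 1) + c i *s u
                            else row i (mat 1 :: real^'n^'n))"
  have "j \<noteq> k" using insert by auto
  have rows: "row i Z = (if i = k then u else if i \<in> S then row i (mat 1) + c i *s u
                         else row i (mat 1 :: real^'n^'n))" for i
    unfolding Z_def by (simp add: row_def vec_lambda_eta)
  have "(\<chi> i. if i = k then u else if i \<in> insert j S then row i (mat 1) + c i *s u
             else row i (mat 1 :: real^'n^'n))
     = (\<chi> m. if m = j then row j Z + c j *s row k Z else row m Z)"
    unfolding rows using \<open>j \<noteq> k\<close> insert.hyps by (intro arg_cong[where f=vec_lambda] ext) auto
  also have "det \<dots> = det Z" by (rule det_row_operation[OF \<open>j \<noteq> k\<close>])
  also have "det Z = u$k" unfolding Z_def using insert.prems by (intro insert.IH) auto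
  finally show ?case .
qed

lemma det_unit_rows_add:
  fixes u w :: "real^'n"
  assumes "finite S"
  shows "det (\<chi> i. if i \<in> S then row i (mat 1) + w$i *s u else row i (mat 1 :: real^'n^'n))
           = 1 + (\<Sum>i\<in>S. w$i * u$i)"
  using assms
proof (induction S rule: finite_induct)
  case empty
  have "(\<chi> i. row i (mat 1 :: real^'n^'n)) = mat 1" by (simp add: row_def vec_lambda_eta)
  then show ?case by simp
next
  case (insert j S)
  define Z where "Z i = (if i \<in> S then row i (mat 1) + w$i *s u else row i (mat 1 :: real^'n^'n))" for i
  have "(\<chi> i. if i \<in> insert j S then row i (mat 1) + w$i *s u else row i (mat 1 :: real^'n^'n))
     = (\<chi> i. if i = j then row i (mat 1) + w$j *s u else Z i)"
    unfolding Z_def by (intro arg_cong[where f=vec_lambda] ext) simp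
  also have "det \<dots> = det (\<chi> i. if i = j then row i (mat 1) else Z i)
                      + det (\<chi> i. if i = j then w$j *s u else Z i)"
    by (rule det_row_add)
  also have "(\<chi> i. if i = j then row i (mat 1) else Z i) = (\<chi> i. Z i)"
    unfolding Z_def using insert.hyps by (intro arg_cong[where f=vec_lambda] ext) simp
  also have "det (\<chi> i. if i = j then w$j *s u else Z i) = w$j * det (\<chi> i. if i = j then u else Z i)"
    by (rule det_row_mul)
  also have "det (\<chi> i. if i = j then u else Z i) = u$j"
    unfolding Z_def by (rule det_unit_rows_replace[OF insert.hyps])
  finally show ?case using insert.IH insert.hyps by (simp add: Z_def algebra_simps)
qed

lemma det_id_add_outer_prod: "det (mat 1 + outer_prod w u) = 1 + w \<bullet> (u::real^'n)"
proof -
  have "mat 1 + outer_prod w u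
      = (\<chi> i. if i \<in> UNIV then row i (mat 1) + w$i *s u else row i (mat 1 :: real^'n^'n))"
    by (simp add: vec_eq_iff outer_prod_def row_def)
  then show ?thesis using det_unit_rows_add[of UNIV w u] by (simp add: inner_vec_def)
qed

lemma det_add_outer_prod:
  fixes M :: "real^'n^'n"
  assumes "M ** M' = mat 1"
  shows "det (M + s *\<^sub>R outer_prod b b) = det M * (1 + s * ((M' *v b) \<bullet> b))"
proof -
  have "M ** (mat 1 + outer_prod (s *\<^sub>R (M' *v b)) b) = M + s *\<^sub>R outer_prod b b"
    using assms
    by (simp add: matrix_add_ldistrib matrix_mul_outer_prod matrix_vector_mul_assoc
        matrix_vector_mult_scaleR outer_prod_scaleR matrix_scalar_ac flip: scalar_matrix_assoc scaleR_matrix_vector_assoc)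
  then show ?thesis
    by (metis det_mul det_id_add_outer_prod inner_scaleR_left)
qed

lemma det_scaleR: "det (a *\<^sub>R X :: real^'n^'n) = a ^ CARD('n) * det X"
proof -
  have "(\<chi> i. a *s X$i) = a *\<^sub>R X" by (simp add: vec_eq_iff)
  then show ?thesis using det_rows_mul[of "\<lambda>_. a" "\<lambda>i. X$i"] by (simp add: vec_lambda_eta)
qed

section \<open>Quadratic majorants of maximal determinant\<close>

lemma le_of_perturbation_le_one:
  fixes \<beta> :: real and m :: nat
  assumes le: "\<And>t. 0 < t \<Longrightarrow> t < 1 \<Longrightarrow> (1 - t) ^ m * (1 + t * (\<beta> - 1)) \<le> 1"
  shows "\<beta> \<le> real m + 1"
proof (rule ccontr)
  assume "\<not> \<beta> \<le> real m + 1"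
  then have \<beta>: "1 \<le> \<beta>" by simp
  have slope: "\<beta> - 1 - real m \<le> real m * (\<beta> - 1) * t" if t: "0 < t" "t < 1" for t
  proof -
    have "1 - real m * t \<le> (1 - t) ^ m"
      using Bernoulli_inequality[of "- t" m] t by simp
    then have "(1 - real m * t) * (1 + t * (\<beta> - 1)) \<le> (1 - t) ^ m * (1 + t * (\<beta> - 1))"
      using \<beta> t by (intro mult_right_mono) auto
    also have "\<dots> \<le> 1" using le t .
    finally have "t * (\<beta> - 1 - real m - real m * (\<beta> - 1) * t) \<le> 0"
      by (simp add: algebra_simps)
    then show ?thesis using t by (simp add: mult_le_0_iff)
  qed
  have "((\<lambda>t. real m * (\<beta> - 1) * t) \<longlongrightarrow> real m * (\<beta> - 1) * 0) (at_right 0)"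
    by (intro tendsto_intros)
  moreover have "\<forall>\<^sub>F t in at_right 0. \<beta> - 1 - real m \<le> real m * (\<beta> - 1) * t"
    using eventually_at_right_real[OF zero_less_one] by eventually_elim (auto intro: slope)
  ultimately have "\<beta> - 1 - real m \<le> real m * (\<beta> - 1) * 0"
    by (rule tendsto_lowerbound) simp
  with \<open>\<not> \<beta> \<le> real m + 1\<close> show False by simp
qed

lemma continuous_on_det: "continuous_on S (det :: real^'n^'n \<Rightarrow> real)"
  unfolding det_def by (intro continuous_intros)

lemma transpose_matrix_add: "transpose (X + Y) = transpose X + transpose (Y::real^'n^'n)"
  by (simp add: vec_eq_iff transpose_def)

lemma inner_axis_matrix_axis: "axis i 1 \<bullet> ((X::real^'n^'n) *v axis j 1) = X$i$j"
proof -
  have "(X *v axis j 1) $ i = X$i$j"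
    using matrix_vector_mul_component[of X "axis j 1" i] by (simp add: inner_axis row_def)
  then show ?thesis by (simp add: inner_axis')
qed

lemma psd_entry_bound:
  fixes X :: "real^'n^'n"
  assumes sym: "transpose X = X" and psd: "\<And>z. 0 \<le> qform X z" and diag: "\<And>k. X$k$k \<le> K"
  shows "\<bar>X$i$j\<bar> \<le> K"
proof -
  let ?ei = "axis i (1::real)" and ?ej = "axis j (1::real)"
  have "X$j$i = X$i$j"
    using arg_cong[OF sym, of "\<lambda>Y. Y$i$j"] by (simp add: transpose_def)
  then have "qform X (?ei + ?ej) = X$i$i + X$j$j + 2 * X$i$j"
    and "qform X (?ei - ?ej) = X$i$i + X$j$j - 2 * X$i$j"
    by (simp_all add: qform_def matrix_vector_right_distrib matrix_vector_mult_diff_distrib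
        inner_add_left inner_add_right inner_diff_left inner_diff_right inner_axis_matrix_axis)
  then show ?thesis
    using psd[of "?ei + ?ej"] psd[of "?ei - ?ej"] diag[of i] diag[of j] by linarith
qed

definition psd_minorants :: "(real^'n \<Rightarrow> real) \<Rightarrow> (real^'n^'n) set" where
  "psd_minorants F = {X. transpose X = X \<and> (\<forall>z. 0 \<le> qform X z) \<and> (\<forall>z. qform X z \<le> F z)}"

lemma convex_psd_minorants: "convex (psd_minorants (F :: real^'n \<Rightarrow> real))"
proof (rule convexI)
  fix X Y :: "real^'n^'n" and u v :: real
  assume "X \<in> psd_minorants F" "Y \<in> psd_minorants F" "0 \<le> u" "0 \<le> v" "u + v = 1"
  then show "u *\<^sub>R X + v *\<^sub>R Y \<in> psd_minorants F"
    unfolding psd_minorants_def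
    by (auto simp: transpose_matrix_add transpose_scalar qform_add qform_scaleR intro: convex_bound_le)
qed

lemma compact_psd_minorants:
  fixes F :: "real^'n \<Rightarrow> real"
  assumes K: "\<And>z. F z \<le> K * (norm z)\<^sup>2"
  shows "compact (psd_minorants F)"
proof -
  have sym: "transpose X = X \<longleftrightarrow> (\<forall>i j. X$i$j = X$j$i)" for X :: "real^'n^'n"
    by (auto simp: vec_eq_iff transpose_def)
  have "closed (psd_minorants F)"
    unfolding psd_minorants_def sym qform_def inner_vec_def matrix_vector_mult_def
    by (intro closed_Collect_conj closed_Collect_all closed_Collect_eq closed_Collect_le
        continuous_intros)
  moreover have "norm X \<le> norm (\<chi> i j. K :: real^'n^'n)" if X: "X \<in> psd_minorants F" for X
  proof -
    have diag: "X$k$k \<le> K" for k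
    proof -
      have "X$k$k = qform X (axis k 1)" by (simp add: qform_def inner_axis_matrix_axis)
      also have "\<dots> \<le> K * (norm (axis k (1::real)))\<^sup>2"
        using X K[of "axis k 1"] unfolding psd_minorants_def by (blast intro: order_trans)
      finally show ?thesis by simp
    qed
    have "\<bar>X$i$j\<bar> \<le> K" for i j
      using X diag unfolding psd_minorants_def by (blast intro: psd_entry_bound)
    then show ?thesis
      by (intro norm_le_componentwise_cart) (auto intro: order_trans[OF _ abs_ge_self])
  qed
  then have "bounded (psd_minorants F)" unfolding bounded_iff by blast
  ultimately show ?thesis by (simp add: compact_eq_bounded_closed)
qed

text \<open>As for John's ellipsoid: moving the maximal-determinant element towards an admissible
  rank-one form cannot increase the determinant, and the first-order term of that determinant
  is b^T M^-1 b - n.\<close>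
lemma max_det_psd_minorant_dominates:
  fixes M :: "real^'n^'n"
  assumes M: "M \<in> psd_minorants F" and max: "\<And>X. X \<in> psd_minorants F \<Longrightarrow> det X \<le> det M"
    and pos: "0 < det M" and b: "\<And>y. (b \<bullet> y)\<^sup>2 \<le> F y"
  shows "(b \<bullet> z)\<^sup>2 \<le> real CARD('n) * qform M z"
proof -
  have sym: "transpose M = M" and psd: "\<And>z. 0 \<le> qform M z"
    using M by (auto simp: psd_minorants_def)
  define u where "u = matrix_inv M *v b"
  have MM': "M ** matrix_inv M = mat 1"
    using pos by (simp add: invertible_det_nz invertible_matrix_inv)
  then have Mu: "M *v u = b" unfolding u_def by (simp add: matrix_vector_mul_assoc)
  have bb: "outer_prod b b \<in> psd_minorants F"
    using b by (simp add: psd_minorants_def transpose_outer_prod qform_outer_prod)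
  define N where "N = CARD('n) - 1"
  have N: "CARD('n) = Suc N" unfolding N_def by simp
  have "(1 - t) ^ N * (1 + t * (u \<bullet> b - 1)) \<le> 1" if t: "0 < t" "t < 1" for t
  proof -
    have "(1 - t) *\<^sub>R M + t *\<^sub>R outer_prod b b = (1 - t) *\<^sub>R (M + (t / (1 - t)) *\<^sub>R outer_prod b b)"
      using t by (simp add: scaleR_add_right)
    then have "det ((1 - t) *\<^sub>R M + t *\<^sub>R outer_prod b b)
        = (1 - t) ^ Suc N * (det M * (1 + t / (1 - t) * (u \<bullet> b)))"
      by (simp add: det_scaleR det_add_outer_prod[OF MM'] u_def N)
    also have "\<dots> = det M * ((1 - t) ^ N * ((1 - t) * (1 + t / (1 - t) * (u \<bullet> b))))"
      by (simp only: power_Suc mult_ac)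
    also have "(1 - t) * (1 + t / (1 - t) * (u \<bullet> b)) = 1 + t * (u \<bullet> b - 1)"
      using t by (simp add: field_simps)
    moreover have "(1 - t) *\<^sub>R M + t *\<^sub>R outer_prod b b \<in> psd_minorants F"
      using t by (intro convexD[OF convex_psd_minorants M bb]) auto
    ultimately have "det M * ((1 - t) ^ N * (1 + t * (u \<bullet> b - 1))) \<le> det M * 1"
      by (metis max mult_1_right)
    then show ?thesis using pos by simp
  qed
  then have ub: "u \<bullet> b \<le> real CARD('n)"
    using le_of_perturbation_le_one[of N "u \<bullet> b"] N by simp
  have "b \<bullet> z = u \<bullet> (M *v z)"
    using inner_matrix_vector_transpose[of u M z] sym Mu by (simp add: inner_commute)
  then have "(b \<bullet> z)\<^sup>2 \<le> qform M u * qform M z"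
    using qform_cauchy_schwarz[OF sym psd] by simp
  also have "qform M u = u \<bullet> b" unfolding qform_def Mu ..
  also have "u \<bullet> b * qform M z \<le> real CARD('n) * qform M z"
    using ub psd[of z] by (rule mult_right_mono)
  finally show ?thesis .
qed

lemma john_quadratic_majorant:
  fixes F :: "real^'n \<Rightarrow> real"
  assumes c: "0 < c" "\<And>z. c * (norm z)\<^sup>2 \<le> F z" and K: "\<And>z. F z \<le> K * (norm z)\<^sup>2"
  obtains R where "transpose R = R" "\<And>z. qform R z \<le> real CARD('n) * F z"
    and "\<And>b z. (\<And>y. (b \<bullet> y)\<^sup>2 \<le> F y) \<Longrightarrow> (b \<bullet> z)\<^sup>2 \<le> qform R z"
proof -
  have qI: "qform (c *\<^sub>R mat 1) z = c * (norm z)\<^sup>2" for z :: "real^'n"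
    unfolding qform_scaleR by (simp add: qform_def power2_norm_eq_inner)
  have cI: "c *\<^sub>R mat 1 \<in> psd_minorants F"
    unfolding psd_minorants_def using qI c by (auto simp: transpose_scalar)
  obtain M where M: "M \<in> psd_minorants F" and max: "\<And>X. X \<in> psd_minorants F \<Longrightarrow> det X \<le> det M"
    using continuous_attains_sup[OF compact_psd_minorants[OF K] _ continuous_on_det] cI by blast
  have "0 < det (c *\<^sub>R mat 1 :: real^'n^'n)" using c by (simp add: det_scaleR)
  with max[OF cI] have pos: "0 < det M" by linarith
  show thesis
  proof (rule that[of "real CARD('n) *\<^sub>R M"])
    show "transpose (real CARD('n) *\<^sub>R M) = real CARD('n) *\<^sub>R M"
      using M by (simp add: psd_minorants_def transpose_scalar)
    show "qform (real CARD('n) *\<^sub>R M) z \<le> real CARD('n) * F z" for z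
      using M by (simp add: psd_minorants_def qform_scaleR)
    show "(b \<bullet> z)\<^sup>2 \<le> qform (real CARD('n) *\<^sub>R M) z" if "\<And>y. (b \<bullet> y)\<^sup>2 \<le> F y" for b z
      using max_det_psd_minorant_dominates[OF M max pos that] by (simp add: qform_scaleR)
  qed
qed

section \<open>Path products and the joint spectral radius\<close>

lemma submultiplicative_le_geometric:
  fixes a :: "nat \<Rightarrow> real"
  assumes nonneg: "\<And>t. 0 \<le> a t" and submult: "\<And>s t. a (s + t) \<le> a s * a t"
    and r: "0 < r" and m: "1 \<le> m" "a m \<le> r ^ m"
  obtains D where "0 < D" "\<And>t. a t \<le> D * r ^ t"
proof -
  define D where "D = 1 + (\<Sum>s<m. a s / r ^ s)"
  have "0 < D" unfolding D_def using nonneg r by (intro add_pos_nonneg sum_nonneg) auto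
  moreover have "a t \<le> D * r ^ t" for t
  proof (induction t rule: less_induct)
    case (less t)
    show ?case
    proof (cases "t < m")
      case True
      have "a t / r ^ t \<le> (\<Sum>s<m. a s / r ^ s)"
        using True nonneg r by (intro member_le_sum) auto
      then have "a t / r ^ t \<le> D" unfolding D_def by simp
      then show ?thesis using r by (simp add: divide_le_eq)
    next
      case False
      then obtain k where k: "t = m + k" by (metis le_add_diff_inverse not_less)
      then have "k < t" using m(1) by simp
      have "a t \<le> a m * a k" using submult k by simp
      also have "\<dots> \<le> r ^ m * (D * r ^ k)"
        using m(2) less.IH[OF \<open>k < t\<close>] nonneg r by (intro mult_mono) auto
      also have "\<dots> = D * r ^ t" using k by (simp add: power_add)
      finally show ?thesis .
    qed
  qed
  ultimately show thesis by (rule that)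
qed

lemma powr_root_le_of_le_geometric:
  fixes x D r :: real
  assumes "0 < D" "0 \<le> r" "1 \<le> t" "0 \<le> x" "x \<le> D * r ^ t"
  shows "x powr (1 / real t) \<le> D powr (1 / real t) * r"
proof -
  have "x powr (1 / real t) \<le> (D * r ^ t) powr (1 / real t)"
    using assms by (intro powr_mono2) auto
  also have "\<dots> = D powr (1 / real t) * (r ^ t) powr (1 / real t)"
    using assms by (simp add: powr_mult)
  also have "(r ^ t) powr (1 / real t) = r"
    using assms by (cases "r = 0") (simp_all add: powr_realpow[symmetric] powr_powr)
  finally show ?thesis .
qed

lemma powr_inverse_tendsto_one: "0 < D \<Longrightarrow> (\<lambda>t. D powr (1 / real t)) \<longlonglongrightarrow> 1"
  using tendsto_powr[OF tendsto_const lim_1_over_n, of D] by simp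

lemma mnorm_nonneg: "0 \<le> mnorm (X::real^'n^'n)"
  unfolding mnorm_def by (rule onorm_pos_le) simp

lemma norm_matrix_vector_le_mnorm: "norm (X *v x) \<le> mnorm (X::real^'n^'n) * norm x"
  unfolding mnorm_def by (rule onorm) simp

lemma mnorm_le: "(\<And>x. norm (X *v x) \<le> b * norm x) \<Longrightarrow> mnorm (X::real^'n^'n) \<le> b"
  unfolding mnorm_def by (rule onorm_le)

lemma mnorm_matrix_mul_le: "mnorm (X ** Y) \<le> mnorm X * mnorm (Y::real^'n^'n)"
proof -
  have "(\<lambda>x. (X ** Y) *v x) = (\<lambda>x. X *v x) \<circ> (\<lambda>x. Y *v x)"
    by (auto simp: matrix_vector_mul_assoc)
  then show ?thesis
    unfolding mnorm_def by (metis onorm_compose matrix_vector_mul_bounded_linear)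
qed

lemma is_path_Nil [simp]: "is_path E []"
  by (simp add: is_path_def)

lemma is_path_Cons:
  "is_path E (e # p) \<longleftrightarrow> e \<in> E \<and> is_path E p \<and> (p \<noteq> [] \<longrightarrow> edge_tgt e = edge_src (hd p))"
proof (cases p)
  case (Cons a q)
  then show ?thesis by (auto simp: is_path_def All_less_Suc2)
qed (simp add: is_path_def)

lemma is_path_append:
  "is_path E (p @ q) \<longleftrightarrow>
     is_path E p \<and> is_path E q \<and> (p \<noteq> [] \<longrightarrow> q \<noteq> [] \<longrightarrow> edge_tgt (last p) = edge_src (hd q))"
  by (induction p) (auto simp: is_path_Cons)

lemma is_path_take: "is_path E p \<Longrightarrow> is_path E (take k p)"
  using is_path_append[of E "take k p" "drop k p"] by simp

lemma is_path_drop: "is_path E p \<Longrightarrow> is_path E (drop k p)"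
  using is_path_append[of E "take k p" "drop k p"] by simp

lemma finite_paths_of_length: "finite E \<Longrightarrow> finite {p. is_path E p \<and> length p = t}"
  by (rule finite_subset[OF _ finite_lists_length_eq[of E t]]) (auto simp: is_path_def)

abbreviation path_matrix :: "('s \<Rightarrow> real^'n^'n) \<Rightarrow> ('v \<times> 'v \<times> 's) list \<Rightarrow> real^'n^'n" where
  "path_matrix A p \<equiv> mat_prod_seq A (map edge_lbl p)"

lemma mat_prod_seq_append: "mat_prod_seq A (xs @ ys) = mat_prod_seq A ys ** mat_prod_seq A xs"
  by (induction xs) (simp_all add: matrix_mul_assoc)

locale switching_system =
  fixes V :: "'v set" and E :: "('v \<times> 'v \<times> 's) set" and A :: "'s \<Rightarrow> real^'n^'n"
  assumes automaton: "automaton V E" and edges_nonempty: "E \<noteq> {}"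
begin

lemma finite_edges: "finite E"
  using automaton by (simp add: automaton_def)

lemma edge_nodes: "e \<in> E \<Longrightarrow> edge_src e \<in> V \<and> edge_tgt e \<in> V"
  using automaton by (simp add: automaton_def)

lemma in_edge_exists:
  assumes v: "v \<in> V"
  shows "\<exists>e\<in>E. edge_tgt e = v"
proof -
  let ?R = "{(a, b). \<exists>s. (a, b, s) \<in> E}"
  have connected: "\<And>x y. x \<in> V \<Longrightarrow> y \<in> V \<Longrightarrow> (x, y) \<in> ?R\<^sup>*"
    using automaton by (simp add: automaton_def)
  have via: "\<exists>e\<in>E. edge_tgt e = v" if "u \<in> V" "u \<noteq> v" for u
    using connected[OF that(1) v]
  proof (cases rule: rtranclE)
    case (step z)
    then obtain s where "(z, v, s) \<in> E" by auto
    then show ?thesis by (force simp: edge_tgt_def)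
  qed (use that in simp)
  obtain x y s where e: "(x, y, s) \<in> E" using edges_nonempty by auto
  then have "x \<in> V" "y \<in> V" using edge_nodes by (auto simp: edge_src_def edge_tgt_def)
  then show ?thesis
    using via e by (cases "x = v"; cases "y = v") (force simp: edge_tgt_def)+
qed

lemma path_ending_at:
  "v \<in> V \<Longrightarrow> \<exists>h. is_path E h \<and> length h = k \<and> (h \<noteq> [] \<longrightarrow> edge_tgt (last h) = v)"
proof (induction k arbitrary: v)
  case (Suc k)
  obtain e where e: "e \<in> E" "edge_tgt e = v" using in_edge_exists[OF Suc.prems] by blast
  then obtain h where h: "is_path E h" "length h = k" "h \<noteq> [] \<longrightarrow> edge_tgt (last h) = edge_src e"
    using Suc.IH edge_nodes by blast
  then have "is_path E (h @ [e])" using e(1) by (simp add: is_path_append is_path_Cons)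
  then show ?case using h(2) e(2) by (intro exI[of _ "h @ [e]"]) auto
qed auto

lemma path_of_length_exists: "\<exists>p. is_path E p \<and> length p = t"
  using edges_nonempty edge_nodes path_ending_at by blast

definition max_norm :: "nat \<Rightarrow> real" where
  "max_norm t = Max {mnorm (path_matrix A p) | p. is_path E p \<and> length p = t}"

lemma finite_path_norms: "finite {mnorm (path_matrix A p) | p. is_path E p \<and> length p = t}"
proof -
  have "{mnorm (path_matrix A p) | p. is_path E p \<and> length p = t}
      = (\<lambda>p. mnorm (path_matrix A p)) ` {p. is_path E p \<and> length p = t}"
    by auto
  then show ?thesis using finite_paths_of_length[OF finite_edges] by simp
qed

lemma mnorm_le_max_norm: "is_path E p \<Longrightarrow> mnorm (path_matrix A p) \<le> max_norm (length p)"
  unfolding max_norm_def by (rule Max_ge[OF finite_path_norms]) auto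

lemma max_norm_attained: "\<exists>p. is_path E p \<and> length p = t \<and> max_norm t = mnorm (path_matrix A p)"
proof -
  have "max_norm t \<in> {mnorm (path_matrix A p) | p. is_path E p \<and> length p = t}"
    unfolding max_norm_def using path_of_length_exists[of t]
    by (intro Max_in[OF finite_path_norms]) auto
  then show ?thesis by auto
qed

lemma max_norm_nonneg: "0 \<le> max_norm t"
  using max_norm_attained[of t] by (auto simp: mnorm_nonneg)

lemma max_norm_submult: "max_norm (s + t) \<le> max_norm s * max_norm t"
proof -
  obtain p where p: "is_path E p" "length p = s + t" "max_norm (s + t) = mnorm (path_matrix A p)"
    using max_norm_attained by blast
  have "path_matrix A p = path_matrix A (drop s p) ** path_matrix A (take s p)"
    by (metis append_take_drop_id map_append mat_prod_seq_append)
  then have "max_norm (s + t) \<le> mnorm (path_matrix A (drop s p)) * mnorm (path_matrix A (take s p))"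
    using p(3) by (simp add: mnorm_matrix_mul_le)
  also have "\<dots> \<le> max_norm t * max_norm s"
    using mnorm_le_max_norm[OF is_path_drop[OF p(1)], of s]
      mnorm_le_max_norm[OF is_path_take[OF p(1)], of s] p(2)
    by (intro mult_mono) (auto simp: mnorm_nonneg max_norm_nonneg)
  finally show ?thesis by (simp add: mult.commute)
qed

definition growth_rate :: real where
  "growth_rate = Inf {max_norm t powr (1 / real t) | t. 1 \<le> t}"

lemma growth_rate_le: "1 \<le> t \<Longrightarrow> growth_rate \<le> max_norm t powr (1 / real t)"
  unfolding growth_rate_def by (rule cInf_lower) (auto intro: bdd_belowI[of _ 0])

lemma growth_rate_nonneg: "0 \<le> growth_rate"
  unfolding growth_rate_def by (rule cInf_greatest) auto

lemma max_norm_le_geometric: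
  assumes r: "growth_rate < r"
  obtains D where "0 < D" "\<And>t. max_norm t \<le> D * r ^ t"
proof -
  have "0 < r" using r growth_rate_nonneg by simp
  obtain m where m: "1 \<le> m" "max_norm m powr (1 / real m) < r"
    using cInf_lessD[of "{max_norm t powr (1 / real t) | t. 1 \<le> t}" r] r
    unfolding growth_rate_def by auto
  have "max_norm m \<le> r ^ m"
  proof (cases "max_norm m = 0")
    case False
    then have "0 < max_norm m" using max_norm_nonneg[of m] by simp
    then have "max_norm m = (max_norm m powr (1 / real m)) ^ m"
      using m(1) by (simp add: powr_realpow[symmetric] powr_powr)
    also have "\<dots> \<le> r ^ m" using m(2) by (intro power_mono) auto
    finally show ?thesis .
  qed (use \<open>0 < r\<close> in simp)
  then show thesis
    using submultiplicative_le_geometric[OF max_norm_nonneg max_norm_submult \<open>0 < r\<close> m(1)] that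
    by blast
qed

lemma max_norm_root_tendsto: "(\<lambda>t. max_norm t powr (1 / real t)) \<longlonglongrightarrow> growth_rate"
proof (rule order_tendstoI)
  fix y assume y: "y < growth_rate"
  show "\<forall>\<^sub>F t in sequentially. y < max_norm t powr (1 / real t)"
    using eventually_ge_at_top[of 1] by eventually_elim (metis y growth_rate_le less_le_trans)
next
  fix y assume y: "growth_rate < y"
  define r where "r = (growth_rate + y) / 2"
  have r: "growth_rate < r" "r < y" "0 \<le> r" using y growth_rate_nonneg unfolding r_def by auto
  obtain D where D: "0 < D" "\<And>t. max_norm t \<le> D * r ^ t" using max_norm_le_geometric[OF r(1)] by blast
  have "(\<lambda>t. D powr (1 / real t) * r) \<longlonglongrightarrow> 1 * r"
    by (intro tendsto_mult powr_inverse_tendsto_one[OF D(1)] tendsto_const)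
  then have "\<forall>\<^sub>F t in sequentially. D powr (1 / real t) * r < y"
    using r(2) by (intro order_tendstoD) auto
  moreover have "\<forall>\<^sub>F t in sequentially. max_norm t powr (1 / real t) \<le> D powr (1 / real t) * r"
    using eventually_ge_at_top[of 1]
    by eventually_elim (use D r max_norm_nonneg in \<open>auto intro: powr_root_le_of_le_geometric\<close>)
  ultimately show "\<forall>\<^sub>F t in sequentially. max_norm t powr (1 / real t) < y"
    by eventually_elim auto
qed

lemma Max_path_norm_powr:
  "Max {mnorm (path_matrix A p) powr (1 / real t) | p. is_path E p \<and> length p = t}
     = max_norm t powr (1 / real t)"
proof -
  let ?N = "{mnorm (path_matrix A p) | p. is_path E p \<and> length p = t}"
  have eq: "{mnorm (path_matrix A p) powr (1 / real t) | p. is_path E p \<and> length p = t}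
      = (\<lambda>x. x powr (1 / real t)) ` ?N"
    by auto
  have "Max ((\<lambda>x. x powr (1 / real t)) ` ?N) = Max ?N powr (1 / real t)"
  proof (rule Max_eqI)
    show "finite ((\<lambda>x. x powr (1 / real t)) ` ?N)" using finite_path_norms by simp
    show "y \<le> Max ?N powr (1 / real t)" if "y \<in> (\<lambda>x. x powr (1 / real t)) ` ?N" for y
      using that by (auto intro!: powr_mono2 Max_ge[OF finite_path_norms] simp: mnorm_nonneg)
    show "Max ?N powr (1 / real t) \<in> (\<lambda>x. x powr (1 / real t)) ` ?N"
      using Max_in[OF finite_path_norms] path_of_length_exists[of t] by auto
  qed
  then show ?thesis unfolding eq max_norm_def .
qed

lemma cjsr_eq_growth_rate: "cjsr E A = growth_rate"
proof -
  have "(\<lambda>t. Max {mnorm (path_matrix A p) powr (1 / real t) | p. is_path E p \<and> length p = t})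
          \<longlonglongrightarrow> growth_rate"
    using max_norm_root_tendsto
    by (rule Lim_transform_eventually)
      (simp add: Max_path_norm_powr)
  then show ?thesis unfolding cjsr_def by (rule limI)
qed

lemma growth_rate_le_of_max_norm_bound:
  assumes K: "0 < K" and g: "0 \<le> g" and bound: "\<And>t. 1 \<le> t \<Longrightarrow> max_norm t \<le> K * g ^ t"
  shows "growth_rate \<le> g"
proof (rule LIMSEQ_le[OF max_norm_root_tendsto])
  show "(\<lambda>t. K powr (1 / real t) * g) \<longlonglongrightarrow> g"
    using tendsto_mult[OF powr_inverse_tendsto_one[OF K] tendsto_const[of g]] by simp
  show "\<exists>N. \<forall>t\<ge>N. max_norm t powr (1 / real t) \<le> K powr (1 / real t) * g"
    using K g bound max_norm_nonneg by (auto intro!: exI[of _ 1] powr_root_le_of_le_geometric)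
qed

end

section \<open>Lyapunov functions on the lift: the lower bound\<close>

definition lyapunov_feasible ::
    "'w set \<Rightarrow> ('w \<times> 'w \<times> 's) set \<Rightarrow> ('s \<Rightarrow> real^'n^'n) \<Rightarrow> real \<Rightarrow> bool" where
  "lyapunov_feasible V' E' A \<gamma> \<longleftrightarrow> (\<exists>Q :: 'w \<Rightarrow> real^'n^'n.
     (\<forall>v\<in>V'. transpose (Q v) = Q v \<and> pos_def (Q v)) \<and>
     (\<forall>(v, w, \<sigma>)\<in>E'. psd (\<gamma>\<^sup>2 *\<^sub>R Q v - transpose (A \<sigma>) ** Q w ** A \<sigma>)))"

lemma gamma_star_eq_Inf_feasible:
  "gamma_star V' E' A = Inf {\<gamma>. 0 \<le> \<gamma> \<and> lyapunov_feasible V' E' A \<gamma>}"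
  unfolding gamma_star_def lyapunov_feasible_def ..

lemma lift_edge_of_path_snoc:
  assumes "h \<in> lift_nodes E M" "is_path E (h @ [e])"
  shows "(h, drop 1 (h @ [e]), edge_lbl e) \<in> lift_edges E M" "drop 1 (h @ [e]) \<in> lift_nodes E M"
proof -
  have "length (h @ [e]) = Suc M" "take M (h @ [e]) = h"
    using assms(1) unfolding lift_nodes_def by simp_all
  then show "(h, drop 1 (h @ [e]), edge_lbl e) \<in> lift_edges E M"
    unfolding lift_edges_def using assms(2) by (intro CollectI exI[of _ "h @ [e]"]) auto
  show "drop 1 (h @ [e]) \<in> lift_nodes E M"
    using assms is_path_drop[OF assms(2), of 1] unfolding lift_nodes_def by auto
qed

lemma lift_lyapunov_along_path:
  fixes Q :: "('v \<times> 'v \<times> 's) list \<Rightarrow> real^'n^'n" and A :: "'s \<Rightarrow> real^'n^'n"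
  assumes decay: "\<forall>(v, w, \<sigma>)\<in>lift_edges E M. psd (g *\<^sub>R Q v - transpose (A \<sigma>) ** Q w ** A \<sigma>)"
    and g: "0 \<le> g"
  shows "h \<in> lift_nodes E M \<Longrightarrow> is_path E (h @ p) \<Longrightarrow>
    drop (length p) (h @ p) \<in> lift_nodes E M \<and>
    qform (Q (drop (length p) (h @ p))) (path_matrix A p *v x) \<le> g ^ length p * qform (Q h) x"
proof (induction p arbitrary: h x)
  case (Cons e p)
  define h' where "h' = drop 1 (h @ [e])"
  have "is_path E (h @ [e])" using Cons.prems(2) is_path_append[of E "h @ [e]" p] by simp
  then have edge: "(h, h', edge_lbl e) \<in> lift_edges E M" and "h' \<in> lift_nodes E M"
    using lift_edge_of_path_snoc[OF Cons.prems(1)] unfolding h'_def by auto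
  have step: "qform (Q h') (A (edge_lbl e) *v x) \<le> g * qform (Q h) x"
    using decay edge by (auto simp: psd_lmi_iff)
  have eq: "h' @ p = drop 1 (h @ e # p)" unfolding h'_def by (cases h) auto
  then have "is_path E (h' @ p)" using is_path_drop[OF Cons.prems(2)] by simp
  have drop: "drop (length p) (h' @ p) = drop (length (e # p)) (h @ e # p)"
    unfolding eq drop_drop length_Cons by (simp only: Suc_eq_plus1)
  have "drop (length (e # p)) (h @ e # p) \<in> lift_nodes E M \<and>
      qform (Q (drop (length (e # p)) (h @ e # p))) (path_matrix A (e # p) *v x)
        \<le> g ^ length p * qform (Q h') (A (edge_lbl e) *v x)"
    using Cons.IH[OF \<open>h' \<in> lift_nodes E M\<close> \<open>is_path E (h' @ p)\<close>, of "A (edge_lbl e) *v x"]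
    unfolding drop by (simp only: mat_prod_seq.simps list.map matrix_vector_mul_assoc)
  moreover have "g ^ length p * qform (Q h') (A (edge_lbl e) *v x) \<le> g ^ length (e # p) * qform (Q h) x"
    using mult_left_mono[OF step zero_le_power[OF g, of "length p"]] by (simp add: mult_ac)
  ultimately show ?case by linarith
qed simp

lemma finite_pos_def_uniform_bounds:
  fixes Q :: "'a \<Rightarrow> real^'n^'n"
  assumes "finite N" "\<And>h. h \<in> N \<Longrightarrow> pos_def (Q h)"
  obtains c C where "0 < c" "0 < C"
    "\<And>h x. h \<in> N \<Longrightarrow> c * (norm x)\<^sup>2 \<le> qform (Q h) x"
    "\<And>h x. h \<in> N \<Longrightarrow> qform (Q h) x \<le> C * (norm x)\<^sup>2"
proof -
  have "\<exists>c>0. \<forall>x. c * (norm x)\<^sup>2 \<le> qform (Q h) x" if "h \<in> N" for h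
    using pos_def_coercive[OF assms(2)[OF that]] by blast
  then obtain cf where cf: "\<And>h. h \<in> N \<Longrightarrow> 0 < cf h \<and> (\<forall>x. cf h * (norm x)\<^sup>2 \<le> qform (Q h) x)"
    by metis
  define c where "c = Min (insert 1 (cf ` N))"
  define C where "C = Max (insert 1 ((\<lambda>h. mnorm (Q h)) ` N))"
  show thesis
  proof (rule that)
    show "0 < c" unfolding c_def using assms(1) cf by auto
    show "0 < C"
      unfolding C_def using assms(1) by (intro less_le_trans[OF zero_less_one Max_ge]) auto
    show "c * (norm x)\<^sup>2 \<le> qform (Q h) x" if "h \<in> N" for h x
    proof -
      have "c \<le> cf h" unfolding c_def using assms(1) that by simp
      then show ?thesis using cf[OF that] by (meson mult_right_mono order_trans zero_le_power2)
    qed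
    show "qform (Q h) x \<le> C * (norm x)\<^sup>2" if "h \<in> N" for h x
    proof -
      have "mnorm (Q h) \<le> C" unfolding C_def using assms(1) that by simp
      then show ?thesis using qform_le_mnorm[of "Q h" x] by (meson mult_right_mono order_trans zero_le_power2)
    qed
  qed
qed

context switching_system
begin

lemma growth_rate_le_of_lift_feasible:
  assumes \<gamma>: "0 \<le> \<gamma>" and feasible: "lyapunov_feasible (lift_nodes E M) (lift_edges E M) A \<gamma>"
  shows "growth_rate \<le> \<gamma>"
proof -
  let ?N = "lift_nodes E M"
  obtain Q :: "('v \<times> 'v \<times> 's) list \<Rightarrow> real^'n^'n"
    where Q: "\<forall>v\<in>?N. transpose (Q v) = Q v \<and> pos_def (Q v)"
      and decay: "\<forall>(v, w, \<sigma>)\<in>lift_edges E M. psd (\<gamma>\<^sup>2 *\<^sub>R Q v - transpose (A \<sigma>) ** Q w ** A \<sigma>)"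
    using feasible unfolding lyapunov_feasible_def by blast
  obtain c C where c: "0 < c" "0 < C"
    and lower: "\<And>h x. h \<in> ?N \<Longrightarrow> c * (norm x)\<^sup>2 \<le> qform (Q h) x"
    and upper: "\<And>h x. h \<in> ?N \<Longrightarrow> qform (Q h) x \<le> C * (norm x)\<^sup>2"
    using finite_pos_def_uniform_bounds[of ?N Q] Q finite_paths_of_length[OF finite_edges]
    unfolding lift_nodes_def by blast
  define K where "K = sqrt (C / c)"
  have "max_norm t \<le> K * \<gamma> ^ t" if "1 \<le> t" for t
  proof -
    obtain p where p: "is_path E p" "length p = t" "max_norm t = mnorm (path_matrix A p)"
      using max_norm_attained by blast
    then have "p \<noteq> []" using that by auto
    then have "hd p \<in> E" using p(1) hd_in_set by (auto simp: is_path_def)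
    then have "edge_src (hd p) \<in> V" using edge_nodes by blast
    then obtain h where h: "is_path E h" "length h = M" "h \<noteq> [] \<longrightarrow> edge_tgt (last h) = edge_src (hd p)"
      using path_ending_at by blast
    have hN: "h \<in> ?N" using h(1,2) by (simp add: lift_nodes_def)
    have hp: "is_path E (h @ p)" using h(1,3) p(1) \<open>p \<noteq> []\<close> by (simp add: is_path_append)
    have "norm (path_matrix A p *v x) \<le> K * \<gamma> ^ t * norm x" for x
    proof -
      let ?h' = "drop (length p) (h @ p)"
      note along = lift_lyapunov_along_path[OF decay zero_le_power2 hN hp, of x]
      have "c * (norm (path_matrix A p *v x))\<^sup>2 \<le> qform (Q ?h') (path_matrix A p *v x)"
        using along by (blast intro: lower)
      also have "\<dots> \<le> (\<gamma>\<^sup>2) ^ t * qform (Q h) x"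
        using along p(2) by simp
      also have "\<dots> \<le> (\<gamma>\<^sup>2) ^ t * (C * (norm x)\<^sup>2)"
        by (intro mult_left_mono upper hN) simp
      also have "\<dots> = c * (K * \<gamma> ^ t * norm x)\<^sup>2"
      proof -
        have "(\<gamma> ^ t)\<^sup>2 = (\<gamma>\<^sup>2) ^ t" by (simp add: power_mult[symmetric] mult.commute)
        moreover have "K\<^sup>2 = C / c" unfolding K_def using c by simp
        ultimately show ?thesis using c by (simp add: power_mult_distrib)
      qed
      finally have "(norm (path_matrix A p *v x))\<^sup>2 \<le> (K * \<gamma> ^ t * norm x)\<^sup>2"
        using c by simp
      then show ?thesis
        by (rule power2_le_imp_le) (use c \<gamma> in \<open>simp add: K_def\<close>)
    qed
    then have "mnorm (path_matrix A p) \<le> K * \<gamma> ^ t" by (rule mnorm_le)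
    with p(3) show ?thesis by simp
  qed
  moreover have "0 < K" unfolding K_def using c by simp
  ultimately show ?thesis by (intro growth_rate_le_of_max_norm_bound[OF _ \<gamma>])
qed

end

section \<open>Extremal norms and the upper bound\<close>

locale switching_system_above_rate = switching_system V E A
  for V :: "'v set" and E :: "('v \<times> 'v \<times> 's) set" and A :: "'s \<Rightarrow> real^'n^'n" +
  fixes r :: real
  assumes above_growth_rate: "growth_rate < r"
begin

lemma rate_pos: "0 < r"
  using above_growth_rate growth_rate_nonneg by simp

text \<open>reach_form v is the square of a dual extremal norm at node v; the set of reach vectors
  is bounded because r exceeds the growth rate.\<close>
definition reach_vectors :: "'v \<Rightarrow> (real^'n) set" where
  "reach_vectors v = {(1 / r ^ length q) *\<^sub>R (path_matrix A q *v u) | q u.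
     is_path E q \<and> (q \<noteq> [] \<longrightarrow> edge_tgt (last q) = v) \<and> norm u = 1}"

definition reach_form :: "'v \<Rightarrow> real^'n \<Rightarrow> real" where
  "reach_form v z = Sup ((\<lambda>b. (b \<bullet> z)\<^sup>2) ` reach_vectors v)"

lemma unit_in_reach_vectors: "norm u = 1 \<Longrightarrow> u \<in> reach_vectors v"
  unfolding reach_vectors_def by (intro CollectI exI[of _ "[]"] exI[of _ u]) simp

lemma reach_vectors_nonempty: "reach_vectors v \<noteq> {}"
proof -
  obtain u :: "real^'n" where "norm u = 1" using vector_choose_size[of 1] by auto
  then have "u \<in> reach_vectors v" by (rule unit_in_reach_vectors)
  then show ?thesis by blast
qed

lemma reach_vectors_bounded:
  obtains D where "0 < D" "\<And>v b. b \<in> reach_vectors v \<Longrightarrow> norm b \<le> D"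
proof -
  obtain D where D: "0 < D" "\<And>t. max_norm t \<le> D * r ^ t"
    using max_norm_le_geometric[OF above_growth_rate] by blast
  have "norm b \<le> D" if b: "b \<in> reach_vectors v" for v b
  proof -
    obtain q u where q: "b = (1 / r ^ length q) *\<^sub>R (path_matrix A q *v u)" "is_path E q" "norm u = 1"
      using b unfolding reach_vectors_def by blast
    have "norm (path_matrix A q *v u) \<le> max_norm (length q)"
      using norm_matrix_vector_le_mnorm[of "path_matrix A q" u] mnorm_le_max_norm[OF q(2)] q(3)
      by simp
    also have "\<dots> \<le> D * r ^ length q" by (rule D(2))
    finally show ?thesis using rate_pos unfolding q(1) by (simp add: divide_le_eq)
  qed
  with D(1) show thesis by (rule that)
qed

lemma reach_vectors_inner_bound:
  obtains K where "\<And>v b z. b \<in> reach_vectors v \<Longrightarrow> (b \<bullet> z)\<^sup>2 \<le> K * (norm z)\<^sup>2"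
proof -
  obtain D where D: "0 < D" "\<And>v b. b \<in> reach_vectors v \<Longrightarrow> norm b \<le> D"
    using reach_vectors_bounded by blast
  have "(b \<bullet> z)\<^sup>2 \<le> D\<^sup>2 * (norm z)\<^sup>2" if "b \<in> reach_vectors v" for v b z
  proof -
    have "\<bar>b \<bullet> z\<bar> \<le> norm b * norm z" by (rule Cauchy_Schwarz_ineq2)
    also have "\<dots> \<le> D * norm z" using D(2)[OF that] by (simp add: mult_right_mono)
    finally have "\<bar>b \<bullet> z\<bar>\<^sup>2 \<le> (D * norm z)\<^sup>2" by (intro power_mono) auto
    then show ?thesis by (simp add: power_mult_distrib)
  qed
  then show thesis by (rule that)
qed

lemma inner_sq_le_reach_form: "b \<in> reach_vectors v \<Longrightarrow> (b \<bullet> z)\<^sup>2 \<le> reach_form v z"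
proof -
  obtain K where K: "\<And>v b z. b \<in> reach_vectors v \<Longrightarrow> (b \<bullet> z)\<^sup>2 \<le> K * (norm z)\<^sup>2"
    using reach_vectors_inner_bound by blast
  assume "b \<in> reach_vectors v"
  then show ?thesis
    unfolding reach_form_def using K
    by (intro cSup_upper) (auto intro!: bdd_aboveI[of _ "K * (norm z)\<^sup>2"])
qed

lemma reach_form_upper:
  obtains K where "\<And>v z. reach_form v z \<le> K * (norm z)\<^sup>2"
proof -
  obtain K where K: "\<And>v b z. b \<in> reach_vectors v \<Longrightarrow> (b \<bullet> z)\<^sup>2 \<le> K * (norm z)\<^sup>2"
    using reach_vectors_inner_bound by blast
  have "reach_form v z \<le> K * (norm z)\<^sup>2" for v z
    unfolding reach_form_def using reach_vectors_nonempty K by (intro cSup_least) auto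
  then show thesis by (rule that)
qed

lemma reach_form_ge_norm: "(norm z)\<^sup>2 \<le> reach_form v z"
proof (cases "z = 0")
  case True
  obtain b where "b \<in> reach_vectors v" using reach_vectors_nonempty by blast
  from inner_sq_le_reach_form[OF this, of z] True show ?thesis by simp
next
  case False
  then have "(1 / norm z) *\<^sub>R z \<in> reach_vectors v" by (intro unit_in_reach_vectors) simp
  from inner_sq_le_reach_form[OF this, of z]
  have "(((1 / norm z) *\<^sub>R z) \<bullet> z)\<^sup>2 \<le> reach_form v z" .
  moreover have "((1 / norm z) *\<^sub>R z) \<bullet> z = norm z"
    using False by (simp add: power2_norm_eq_inner[symmetric] power2_eq_square)
  ultimately show ?thesis by simp
qed

text \<open>Extending a path q ending at the source of p by p turns a reach vector at src p into
  r^|p| times a reach vector at tgt p.\<close>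
lemma reach_form_along_path:
  assumes p: "is_path E p" "p \<noteq> []"
  shows "reach_form (edge_src (hd p)) (transpose (path_matrix A p) *v y)
           \<le> (r ^ length p)\<^sup>2 * reach_form (edge_tgt (last p)) y"
  unfolding reach_form_def[of "edge_src (hd p)"]
proof (rule cSup_least)
  show "(\<lambda>b. (b \<bullet> (transpose (path_matrix A p) *v y))\<^sup>2) ` reach_vectors (edge_src (hd p)) \<noteq> {}"
    using reach_vectors_nonempty by simp
next
  fix x assume "x \<in> (\<lambda>b. (b \<bullet> (transpose (path_matrix A p) *v y))\<^sup>2) ` reach_vectors (edge_src (hd p))"
  then obtain q u where x: "x = (((1 / r ^ length q) *\<^sub>R (path_matrix A q *v u)) \<bullet> (transpose (path_matrix A p) *v y))\<^sup>2"
    and q: "is_path E q" "q \<noteq> [] \<longrightarrow> edge_tgt (last q) = edge_src (hd p)" "norm u = 1"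
    unfolding reach_vectors_def by blast
  define b' where "b' = (1 / r ^ length (q @ p)) *\<^sub>R (path_matrix A (q @ p) *v u)"
  have "b' \<in> reach_vectors (edge_tgt (last p))"
    unfolding reach_vectors_def b'_def using p q
    by (intro CollectI exI[of _ "q @ p"] exI[of _ u]) (auto simp: is_path_append)
  then have b': "(b' \<bullet> y)\<^sup>2 \<le> reach_form (edge_tgt (last p)) y" by (rule inner_sq_le_reach_form)
  have "((1 / r ^ length q) *\<^sub>R (path_matrix A q *v u)) \<bullet> (transpose (path_matrix A p) *v y)
      = (path_matrix A p *v ((1 / r ^ length q) *\<^sub>R (path_matrix A q *v u))) \<bullet> y"
    by (metis inner_commute inner_matrix_vector_transpose)
  also have "\<dots> = r ^ length p * (b' \<bullet> y)"
    unfolding b'_def using rate_pos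
    by (simp add: mat_prod_seq_append matrix_vector_mul_assoc matrix_vector_mult_scaleR power_add)
  finally have "x = (r ^ length p)\<^sup>2 * (b' \<bullet> y)\<^sup>2"
    unfolding x by (simp add: power_mult_distrib)
  also have "\<dots> \<le> (r ^ length p)\<^sup>2 * reach_form (edge_tgt (last p)) y"
    using b' by (intro mult_left_mono) auto
  finally show "x \<le> (r ^ length p)\<^sup>2 * reach_form (edge_tgt (last p)) y" .
qed

lemma extremal_quadratic_forms:
  obtains R :: "'v \<Rightarrow> real^'n^'n" where "\<And>v. transpose (R v) = R v"
    and "\<And>v y. (norm y)\<^sup>2 \<le> qform (R v) y"
    and "\<And>p y. is_path E p \<Longrightarrow> p \<noteq> [] \<Longrightarrow>
      qform (R (edge_src (hd p))) (transpose (path_matrix A p) *v y)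
        \<le> real CARD('n) * (r ^ length p)\<^sup>2 * qform (R (edge_tgt (last p))) y"
proof -
  obtain K where K: "\<And>v z. reach_form v z \<le> K * (norm z)\<^sup>2"
    using reach_form_upper by blast
  have "\<exists>R. transpose R = R \<and> (\<forall>z. qform R z \<le> real CARD('n) * reach_form v z)
           \<and> (\<forall>b z. (\<forall>y. (b \<bullet> y)\<^sup>2 \<le> reach_form v y) \<longrightarrow> (b \<bullet> z)\<^sup>2 \<le> qform R z)" for v
  proof -
    obtain R where "transpose R = R" "\<And>z. qform R z \<le> real CARD('n) * reach_form v z"
      and "\<And>b z. (\<And>y. (b \<bullet> y)\<^sup>2 \<le> reach_form v y) \<Longrightarrow> (b \<bullet> z)\<^sup>2 \<le> qform R z"
      by (rule john_quadratic_majorant[of 1 "reach_form v" K]) (use reach_form_ge_norm K in auto)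
    then show ?thesis by blast
  qed
  then obtain R where sym: "\<And>v. transpose (R v) = R v"
    and upper: "\<And>v z. qform (R v) z \<le> real CARD('n) * reach_form v z"
    and major: "\<And>v b z. (\<forall>y. (b \<bullet> y)\<^sup>2 \<le> reach_form v y) \<Longrightarrow> (b \<bullet> z)\<^sup>2 \<le> qform (R v) z"
    by metis
  have lower: "reach_form v z \<le> qform (R v) z" for v z
    unfolding reach_form_def using reach_vectors_nonempty inner_sq_le_reach_form major
    by (intro cSup_least) auto
  show thesis
  proof (rule that[OF sym])
    show "(norm y)\<^sup>2 \<le> qform (R v) y" for v y
      using reach_form_ge_norm lower order_trans by blast
    fix p y assume p: "is_path E p" "p \<noteq> []"
    have "qform (R (edge_src (hd p))) (transpose (path_matrix A p) *v y)
        \<le> real CARD('n) * reach_form (edge_src (hd p)) (transpose (path_matrix A p) *v y)"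
      by (rule upper)
    also have "\<dots> \<le> real CARD('n) * ((r ^ length p)\<^sup>2 * reach_form (edge_tgt (last p)) y)"
      using reach_form_along_path[OF p] by (intro mult_left_mono) auto
    also have "\<dots> \<le> real CARD('n) * ((r ^ length p)\<^sup>2 * qform (R (edge_tgt (last p))) y)"
      using lower by (intro mult_left_mono) auto
    finally show "qform (R (edge_src (hd p))) (transpose (path_matrix A p) *v y)
        \<le> real CARD('n) * (r ^ length p)\<^sup>2 * qform (R (edge_tgt (last p))) y"
      by (simp add: mult.assoc)
  qed
qed

end

text \<open>For a history h = [h_1, ..., h_M], history_form A g R (tgt h_M) (rev h) is the sum over
  its suffixes h_(j+1) ... h_M of g^-(M-j) B R_(src h_(j+1)) B^T with B = A_(h_M) ... A_(h_(j+1))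
  (the term j = M being R_(tgt h_M)).\<close>
fun history_form ::
    "('s \<Rightarrow> real^'n^'n) \<Rightarrow> real \<Rightarrow> ('v \<Rightarrow> real^'n^'n) \<Rightarrow> 'v \<Rightarrow> ('v \<times> 'v \<times> 's) list \<Rightarrow> real^'n^'n"
  where
    "history_form A g R v [] = R v"
  | "history_form A g R v (e # l) =
       R v + (1 / g) *\<^sub>R (A (edge_lbl e) ** history_form A g R (edge_src e) l ** transpose (A (edge_lbl e)))"

lemma history_form_symmetric:
  assumes "\<And>v. transpose (R v) = R v"
  shows "transpose (history_form A g R v l) = history_form A g R v l"
  by (induction l arbitrary: v)
    (simp_all add: assms transpose_matrix_add transpose_scalar matrix_transpose_mul matrix_mul_assoc)

lemma qform_history_form_ge:
  assumes "\<And>v y. 0 \<le> qform (R v) y" and "0 < g"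
  shows "qform (R v) y \<le> qform (history_form A g R v l) y"
proof (induction l arbitrary: v y)
  case (Cons e l)
  have "0 \<le> qform (history_form A g R (edge_src e) l) (transpose (A (edge_lbl e)) *v y)"
    using Cons.IH assms(1) order_trans by blast
  then show ?case
    using assms(2) by (simp add: qform_add qform_scaleR qform_congruence_transpose)
qed simp

lemma qform_history_form_snoc:
  "l \<noteq> [] \<Longrightarrow> qform (history_form A g R v l) y = qform (history_form A g R v (butlast l)) y
      + (1 / g) ^ length l * qform (R (edge_src (last l))) (transpose (path_matrix A (rev l)) *v y)"
proof (induction l arbitrary: v y)
  case (Cons e l)
  show ?case
  proof (cases "l = []")
    case False
    have "path_matrix A (rev (e # l)) = A (edge_lbl e) ** path_matrix A (rev l)"
      by (simp add: mat_prod_seq_append)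
    then have "transpose (path_matrix A (rev (e # l))) *v y
        = transpose (path_matrix A (rev l)) *v (transpose (A (edge_lbl e)) *v y)"
      by (simp only: matrix_transpose_mul matrix_vector_mul_assoc)
    with Cons.IH[OF False] False show ?thesis
      by (simp add: qform_add qform_scaleR qform_congruence_transpose algebra_simps)
  qed (simp add: qform_add qform_scaleR qform_congruence_transpose)
qed simp

text \<open>One step along e shifts the window of the sum, dropping its oldest term, which the bound
  on R along the whole path h @ [e] controls.\<close>
lemma qform_history_form_step:
  fixes R :: "'v \<Rightarrow> real^'n^'n"
  assumes g: "0 < g" and p: "is_path E (h @ [e])" "h \<noteq> []"
    and transfer: "qform (R (edge_src (hd h))) (transpose (path_matrix A (h @ [e])) *v y)
                     \<le> g ^ Suc (length h) * qform (R (edge_tgt e)) y"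
  shows "qform (history_form A g R (edge_tgt (last h)) (rev h)) (transpose (A (edge_lbl e)) *v y)
    \<le> g * qform (history_form A g R (edge_tgt e) (rev (tl h @ [e]))) y"
proof -
  let ?y = "transpose (A (edge_lbl e)) *v y"
  define X where "X = qform (history_form A g R (edge_src e) (rev (tl h))) ?y"
  have src: "edge_src e = edge_tgt (last h)" using p by (simp add: is_path_append is_path_Cons)
  have new: "qform (history_form A g R (edge_tgt e) (rev (tl h @ [e]))) y = qform (R (edge_tgt e)) y + (1 / g) * X"
    unfolding X_def by (simp add: qform_add qform_scaleR qform_congruence_transpose)
  have "path_matrix A (h @ [e]) = A (edge_lbl e) ** path_matrix A h"
    by (simp add: mat_prod_seq_append)
  then have "transpose (path_matrix A h) *v ?y = transpose (path_matrix A (h @ [e])) *v y"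
    by (simp only: matrix_transpose_mul matrix_vector_mul_assoc)
  then have "qform (history_form A g R (edge_tgt (last h)) (rev h)) ?y
      = X + (1 / g) ^ length h * qform (R (edge_src (hd h))) (transpose (path_matrix A (h @ [e])) *v y)"
    using qform_history_form_snoc[of "rev h" A g R "edge_tgt (last h)" ?y] p(2)
    by (simp add: X_def src butlast_rev last_rev)
  also have "\<dots> \<le> X + (1 / g) ^ length h * (g ^ Suc (length h) * qform (R (edge_tgt e)) y)"
    using transfer g by (intro add_left_mono mult_left_mono) auto
  also have "\<dots> = g * qform (history_form A g R (edge_tgt e) (rev (tl h @ [e]))) y"
    unfolding new using g by (simp add: field_simps)
  finally show ?thesis .
qed

lemma powr_inverse_power:
  assumes "0 < x" "0 < k"
  shows "(x powr (1 / real k)) ^ k = x"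
  using assms by (simp add: powr_realpow[symmetric] powr_powr)

context switching_system_above_rate
begin

lemma lift_feasible_above_growth_rate:
  assumes M: "1 \<le> M"
  shows "lyapunov_feasible (lift_nodes E M) (lift_edges E M) A
           (real CARD('n) powr (1 / (2 * (real M + 1))) * r)"
proof -
  define \<gamma> where "\<gamma> = real CARD('n) powr (1 / (2 * (real M + 1))) * r"
  define g where "g = \<gamma>\<^sup>2"
  have "0 < \<gamma>" unfolding \<gamma>_def using rate_pos by simp
  then have g: "0 < g" unfolding g_def by simp
  have g_pow: "g ^ Suc M = real CARD('n) * (r ^ Suc M)\<^sup>2"
  proof -
    have "g ^ Suc M = \<gamma> ^ (2 * Suc M)" unfolding g_def by (simp only: power_mult)
    also have "\<dots> = (real CARD('n) powr (1 / real (2 * Suc M))) ^ (2 * Suc M) * r ^ (2 * Suc M)"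
    proof -
      have "real (2 * Suc M) = 2 * (real M + 1)" by simp
      then show ?thesis unfolding \<gamma>_def power_mult_distrib by (simp only:)
    qed
    also have "(real CARD('n) powr (1 / real (2 * Suc M))) ^ (2 * Suc M) = real CARD('n)"
      by (rule powr_inverse_power) auto
    also have "r ^ (2 * Suc M) = (r ^ Suc M)\<^sup>2" by (metis power_mult mult.commute)
    finally show ?thesis .
  qed
  obtain R :: "'v \<Rightarrow> real^'n^'n" where sym: "\<And>v. transpose (R v) = R v"
    and ge_norm: "\<And>v y. (norm y)\<^sup>2 \<le> qform (R v) y"
    and along: "\<And>p y. is_path E p \<Longrightarrow> p \<noteq> [] \<Longrightarrow>
      qform (R (edge_src (hd p))) (transpose (path_matrix A p) *v y)
        \<le> real CARD('n) * (r ^ length p)\<^sup>2 * qform (R (edge_tgt (last p))) y"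
    using extremal_quadratic_forms by blast
  define P where "P h = history_form A g R (edge_tgt (last h)) (rev h)" for h
  have R_nonneg: "0 \<le> qform (R v) y" for v y
    by (rule order_trans[OF zero_le_power2 ge_norm])
  have P: "transpose (P h) = P h" "pos_def (P h)" for h
    unfolding P_def
    by (rule history_form_symmetric[OF sym],
        rule pos_def_if_qform_ge_norm, rule order_trans[OF ge_norm qform_history_form_ge[OF R_nonneg g]])
  show ?thesis
    unfolding lyapunov_feasible_def \<gamma>_def[symmetric]
  proof (intro exI[of _ "\<lambda>h. matrix_inv (P h)"] conjI ballI)
    fix h show "transpose (matrix_inv (P h)) = matrix_inv (P h)" "pos_def (matrix_inv (P h))"
      using pos_def_matrix_inv[OF P] by auto
  next
    fix edge assume "edge \<in> lift_edges E M"
    then obtain p where edge: "edge = (take M p, drop 1 p, edge_lbl (last p))"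
      and p: "is_path E p" "length p = Suc M"
      unfolding lift_edges_def by blast
    define h where "h = take M p"
    define e where "e = last p"
    have p_eq: "p = h @ [e]" unfolding h_def e_def using p(2)
      by (metis append_butlast_last_id butlast_conv_take diff_Suc_1 length_0_conv nat.distinct(1))
    have "h \<noteq> []" "length h = M" unfolding h_def using M p(2) by auto
    have "drop 1 p = tl h @ [e]" unfolding p_eq using \<open>h \<noteq> []\<close> by (cases h) auto
    have path: "is_path E (h @ [e])" "h @ [e] \<noteq> []" using p(1) p_eq by auto
    have transfer: "qform (R (edge_src (hd h))) (transpose (path_matrix A (h @ [e])) *v y)
        \<le> g ^ Suc (length h) * qform (R (edge_tgt e)) y" for y
      using along[OF path, of y]
      unfolding hd_append2[OF \<open>h \<noteq> []\<close>] last_snoc length_append_singleton \<open>length h = M\<close> g_pow .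
    have "qform (P h) (transpose (A (edge_lbl e)) *v y) \<le> g * qform (P (tl h @ [e])) y" for y
      unfolding P_def last_snoc by (rule qform_history_form_step[OF g path(1) \<open>h \<noteq> []\<close> transfer])
    then have "qform (matrix_inv (P (tl h @ [e]))) (A (edge_lbl e) *v z) \<le> g * qform (matrix_inv (P h)) z" for z
      using g by (intro qform_matrix_inv_transfer P) auto
    then show "case edge of (v, w, \<sigma>) \<Rightarrow>
        psd (\<gamma>\<^sup>2 *\<^sub>R matrix_inv (P v) - transpose (A \<sigma>) ** matrix_inv (P w) ** A \<sigma>)"
      unfolding edge h_def[symmetric] e_def[symmetric] \<open>drop 1 p = tl h @ [e]\<close> psd_lmi_iff g_def
      by simp
  qed
qed

end

lemma Inf_between_bound_and_scaled_bound:
  fixes S :: "real set" and L c :: real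
  assumes lower: "\<And>x. x \<in> S \<Longrightarrow> L \<le> x" and upper: "\<And>r. L < r \<Longrightarrow> c * r \<in> S" and c: "0 < c"
  shows "L \<le> Inf S" "Inf S \<le> c * L"
proof -
  have bdd: "bdd_below S" using lower by (rule bdd_belowI)
  show "L \<le> Inf S" using upper[of "L + 1"] lower by (intro cInf_greatest) auto
  have "Inf S / c \<le> L"
  proof (rule dense_ge)
    fix r assume "L < r"
    then have "Inf S \<le> c * r" by (intro cInf_lower[OF upper bdd])
    then show "Inf S / c \<le> r" using c by (simp add: divide_le_eq mult.commute)
  qed
  then show "Inf S \<le> c * L" using c by (simp add: divide_le_eq mult.commute)
qed

theorem corollary3p10:
  fixes V :: "'v set" and E :: "('v \<times> 'v \<times> 's) set"
    and A :: "'s \<Rightarrow> real^'n^'n" and M :: nat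
  assumes "automaton V E" and "E \<noteq> {}" and "1 \<le> M"
  shows "cjsr E A \<le> gamma_star (lift_nodes E M) (lift_edges E M) A \<and>
         gamma_star (lift_nodes E M) (lift_edges E M) A
           \<le> real CARD('n) powr (1 / (2 * (real M + 1))) * cjsr E A"
proof -
  interpret switching_system V E A
    using assms(1,2) by unfold_locales
  define S where "S = {\<gamma>. 0 \<le> \<gamma> \<and> lyapunov_feasible (lift_nodes E M) (lift_edges E M) A \<gamma>}"
  have lower: "growth_rate \<le> \<gamma>" if "\<gamma> \<in> S" for \<gamma>
    using that growth_rate_le_of_lift_feasible unfolding S_def by blast
  have upper: "real CARD('n) powr (1 / (2 * (real M + 1))) * r \<in> S" if "growth_rate < r" for r
  proof -
    interpret switching_system_above_rate V E A r
      using that by unfold_locales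
    show ?thesis
      using lift_feasible_above_growth_rate[OF assms(3)] rate_pos unfolding S_def by simp
  qed
  have "0 < real CARD('n) powr (1 / (2 * (real M + 1)))" by simp
  from Inf_between_bound_and_scaled_bound[OF lower upper this] show ?thesis
    unfolding gamma_star_eq_Inf_feasible cjsr_eq_growth_rate S_def[symmetric] by simp
qed

end
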